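(* There exists an infinite non-amenable torsion group.
   Context: A torsion group is a group all of whose elements have finite order; amenability is that of discrete groups. *)

theory Defs
  imports Complex_Main "HOL-Algebra.Coset"
begin

definition torsion_group :: "('a, 'b) monoid_scheme \<Rightarrow> bool" where
  "torsion_group G \<longleftrightarrow>
     group G \<and> (\<forall>x\<in>carrier G. \<exists>n::nat. n > 0 \<and> x [^]\<^bsub>G\<^esub> n = \<one>\<^bsub>G\<^esub>)"

text \<open>
  A discrete group is amenable if it carries a left-invariant, finitely additive probability
  measure defined on all of its subsets. The values of \<open>\<mu>\<close> on sets that are not contained in the
  carrier are irrelevant.
\<close>

definition invariant_fa_prob :: "('a, 'b) monoid_scheme \<Rightarrow> ('a set \<Rightarrow> real) \<Rightarrow> bool" where
  "invariant_fa_prob G \<mu> \<longleftrightarrow>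
     (\<forall>A. A \<subseteq> carrier G \<longrightarrow> 0 \<le> \<mu> A) \<and>
     \<mu> (carrier G) = 1 \<and>
     (\<forall>A B. A \<subseteq> carrier G \<longrightarrow> B \<subseteq> carrier G \<longrightarrow> A \<inter> B = {} \<longrightarrow> \<mu> (A \<union> B) = \<mu> A + \<mu> B) \<and>
     (\<forall>g\<in>carrier G. \<forall>A. A \<subseteq> carrier G \<longrightarrow> \<mu> (g <#\<^bsub>G\<^esub> A) = \<mu> A)"

definition amenable_group :: "('a, 'b) monoid_scheme \<Rightarrow> bool" where
  "amenable_group G \<longleftrightarrow> group G \<and> (\<exists>\<mu>. invariant_fa_prob G \<mu>)"

end

theory Submission
  imports Defs "HOL-Library.Z2" "HOL-Library.Countable" "HOL-Computational_Algebra.Primes"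
begin

text \<open>
  The group is \<open>G = \<langle>x, y, z | w\<^sup>e\<^sup>(\<^sup>w\<^sup>)\<rangle>\<close>, made residually finite, where \<open>w\<close> runs over all
  positive words and the exponents \<open>e(w)\<close> are powers of 2 with \<open>\<Sum> 1 / e(w) \<le> 1\<close>. All words have
  finite order, so the positive words already form a group, and it is a torsion group. As finite
  groups are amenable, all the work is to show that \<open>G\<close> is not amenable. The point is that the
  relators are so sparse that every finite quotient of \<open>G\<close> has many \<open>\<int>/2\<close>-valued cocycles, more
  than the coboundaries on a Folner set could account for.

  Let \<open>Q\<close> be a finite quotient of the free monoid in which all relators hold, \<open>m\<close> its order,
  and \<open>n\<close> the number of letters. The labellings of the \<open>n m\<close> edges of the Cayley graph of \<open>Q\<close> by
  elements of \<open>\<int>/2\<close> form a group of order \<open>2\<^sup>n\<^sup>m\<close>; a labelling is \<^emph>\<open>balanced\<close> if all relator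
  paths have sum zero. Two observations are made about balanced labellings.

  \<^item> There are at least \<open>2\<^sup>(\<^sup>n\<^sup>-\<^sup>1\<^sup>)\<^sup>m\<close> of them (\<open>labellings_le_balanced\<close>). The relator
    \<open>w\<^sup>e\<close> imposes at most \<open>m / e\<close> linear conditions: its path sums are norms over the \<open>w\<close>-orbits
    in \<open>Q\<close>, so they are constant on orbits, and they vanish identically if the orbits are shorter
    than \<open>e\<close>, because every orbit is then traversed an even number of times
    (\<open>card_relator_sums_le\<close>).

  \<^item> A balanced labelling defines a double cover of the Cayley graph, and the action of the words
    on it yields another finite quotient in which all relators hold (\<open>skew_product\<close>). Hence the
    sum along a path that starts at a given vertex depends only on the element of \<open>G\<close> that the
    path spells. A balanced labelling thus has a potential on the image of any finite \<open>F \<subseteq> G\<close>.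

  Now let \<open>F \<subseteq> G\<close> be finite, choose \<open>Q\<close> such that \<open>F\<close> embeds into it, and consider the
  \<open>m\<close> translates \<open>F t\<close>. By linear algebra there are at least \<open>(n-1) m\<close> edges on which the values of a
  balanced labelling can be prescribed freely; on average, at least \<open>(n-1) |F|\<close> of them start in \<open>F t\<close>.
  But the values on edges that start in \<open>F t\<close> are determined by a potential on \<open>F \<union> X F\<close>, where \<open>X\<close> is
  the set of letters. Therefore \<open>(n-1) |F| \<le> |F \<union> X F|\<close> (\<open>expansion\<close>). For \<open>n = 3\<close> every finite
  set at least doubles, and Hall's marriage theorem turns this into a paradoxical decomposition
  (\<open>doubling_not_amenable\<close>).
\<close>

section \<open>Doubling groups are not amenable\<close>

text \<open>
  Rado's proof of the marriage theorem: delete elements from the sets \<open>A j\<close> as long as Hall's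
  condition survives. A maximal set of deletions exists by Zorn's lemma, since Hall's condition
  concerns finitely many finite sets at a time. It leaves singletons: if two elements of some
  \<open>A j\<close> were left, deleting either would violate Hall's condition, and the two violations
  contradict each other by inclusion and exclusion.
\<close>

lemma infinite_hall:
  fixes A :: "'j \<Rightarrow> 'b set"
  assumes fin: "\<And>j. j \<in> J \<Longrightarrow> finite (A j)"
    and hall: "\<And>F. finite F \<Longrightarrow> F \<subseteq> J \<Longrightarrow> card F \<le> card (\<Union>j\<in>F. A j)"
  shows "\<exists>\<phi>. inj_on \<phi> J \<and> (\<forall>j\<in>J. \<phi> j \<in> A j)"
proof -
  define nb where "nb K F = {y. \<exists>j\<in>F. y \<in> A j \<and> (j, y) \<notin> K}" for K F
  define \<K> where "\<K> = {K. \<forall>F. finite F \<longrightarrow> F \<subseteq> J \<longrightarrow> card F \<le> card (nb K F)}"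
  have nb_finite: "finite (nb K F)" if "finite F" "F \<subseteq> J" for K F
  proof (rule finite_subset)
    show "nb K F \<subseteq> (\<Union>j\<in>F. A j)" by (auto simp: nb_def)
    show "finite (\<Union>j\<in>F. A j)" using that fin by auto
  qed
  have "\<exists>M\<in>\<K>. \<forall>X\<in>\<K>. M \<subseteq> X \<longrightarrow> X = M"
  proof (rule subset_Zorn)
    fix C assume C: "subset.chain \<K> C"
    show "\<exists>U\<in>\<K>. \<forall>X\<in>C. X \<subseteq> U"
    proof (cases "C = {}")
      case True
      have "{} \<in> \<K>" using hall by (auto simp: \<K>_def nb_def Collect_bex_eq)
      then show ?thesis using True by auto
    next
      case False
      have "\<Union>C \<in> \<K>"
        unfolding \<K>_def
      proof (intro CollectI allI impI)
        fix F assume F: "finite F" "F \<subseteq> J"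
        \<comment> \<open>only finitely many deletions concern \<open>F\<close>, so one member of the chain makes them all\<close>
        have "finite (\<Union>C \<inter> Sigma F A)"
          using F fin by (intro finite_Int disjI2 finite_SigmaI) auto
        then obtain K where K: "K \<in> C" "\<Union>C \<inter> Sigma F A \<subseteq> K"
          using finite_subset_Union_chain[OF _ _ False C, of "\<Union>C \<inter> Sigma F A"] by auto
        then have "nb (\<Union>C) F = nb K F" by (auto simp: nb_def)
        moreover have "K \<in> \<K>" using K C by (auto simp: subset.chain_def)
        ultimately show "card F \<le> card (nb (\<Union>C) F)" using F by (simp add: \<K>_def)
      qed
      then show ?thesis by auto
    qed
  qed
  then obtain M where M: "M \<in> \<K>" and max: "\<And>X. X \<in> \<K> \<Longrightarrow> M \<subseteq> X \<Longrightarrow> X = M" by blast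
  have hall_M: "card F \<le> card (nb M F)" if "finite F" "F \<subseteq> J" for F
    using M that by (simp add: \<K>_def)
  have unique: "x = y" if j: "j \<in> J" and x: "x \<in> A j" "(j, x) \<notin> M" and y: "y \<in> A j" "(j, y) \<notin> M" for j x y
  proof (rule ccontr)
    assume "x \<noteq> y"
    have violated: "\<exists>F. finite F \<and> F \<subseteq> J \<and> j \<in> F \<and> card (nb (insert (j, z) M) F) < card F"
      if "(j, z) \<notin> M" for z
    proof -
      have "insert (j, z) M \<notin> \<K>" using max[of "insert (j, z) M"] that by blast
      then obtain F where F: "finite F" "F \<subseteq> J" "card (nb (insert (j, z) M) F) < card F"
        by (auto simp: \<K>_def not_le)
      moreover have "j \<in> F"
      proof (rule ccontr)
        assume "j \<notin> F"
        then have "nb (insert (j, z) M) F = nb M F" by (auto simp: nb_def)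
        then show False using F hall_M[of F] by simp
      qed
      ultimately show ?thesis by blast
    qed
    obtain F1 where F1: "finite F1" "F1 \<subseteq> J" "j \<in> F1" "card (nb (insert (j, x) M) F1) < card F1"
      using violated[OF x(2)] by blast
    obtain F2 where F2: "finite F2" "F2 \<subseteq> J" "j \<in> F2" "card (nb (insert (j, y) M) F2) < card F2"
      using violated[OF y(2)] by blast
    let ?X = "nb (insert (j, x) M) F1" and ?Y = "nb (insert (j, y) M) F2"
    have fX: "finite ?X" and fY: "finite ?Y" using F1 F2 nb_finite by auto
    have "card (F1 \<union> F2) \<le> card (nb M (F1 \<union> F2))"
      using F1 F2 by (intro hall_M) auto
    also have "\<dots> \<le> card (?X \<union> ?Y)"
      using fX fY F1(3) F2(3) \<open>x \<noteq> y\<close> by (intro card_mono) (auto simp: nb_def)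
    finally have 1: "card (F1 \<union> F2) \<le> card (?X \<union> ?Y)" .
    have "card (F1 \<inter> F2 - {j}) \<le> card (nb M (F1 \<inter> F2 - {j}))"
      using F1 by (intro hall_M) auto
    also have "\<dots> \<le> card (?X \<inter> ?Y)"
      using fX fY by (intro card_mono) (auto simp: nb_def)
    finally have 2: "card (F1 \<inter> F2) - 1 \<le> card (?X \<inter> ?Y)"
      using F1 F2 by (simp add: card_Diff_singleton)
    have "card (F1 \<inter> F2) > 0" using F1 F2 by (auto simp: card_gt_0_iff)
    then show False
      using 1 2 F1(4) F2(4) card_Un_Int[OF fX fY] card_Un_Int[OF F1(1) F2(1)] by linarith
  qed
  have "\<exists>y. y \<in> A j \<and> (j, y) \<notin> M" if "j \<in> J" for j
  proof -
    have "card {j} \<le> card (nb M {j})"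
      using that by (intro hall_M) auto
    then have "nb M {j} \<noteq> {}" by auto
    then show ?thesis by (auto simp: nb_def)
  qed
  then obtain \<phi> where \<phi>: "\<And>j. j \<in> J \<Longrightarrow> \<phi> j \<in> A j \<and> (j, \<phi> j) \<notin> M" by metis
  have "inj_on \<phi> J"
  proof (rule inj_onI, rule ccontr)
    fix i j assume ij: "i \<in> J" "j \<in> J" "\<phi> i = \<phi> j" "i \<noteq> j"
    have "card {i, j} \<le> card (nb M {i, j})"
      using ij by (intro hall_M) auto
    moreover have "nb M {i, j} \<subseteq> {\<phi> i}"
    proof
      fix y assume "y \<in> nb M {i, j}"
      then obtain l where l: "l \<in> {i, j}" "y \<in> A l" "(l, y) \<notin> M" by (auto simp: nb_def)
      then have "y = \<phi> l" using \<phi>[of l] ij by (intro unique[of l]) auto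
      then show "y \<in> {\<phi> i}" using l ij by auto
    qed
    then have "card (nb M {i, j}) \<le> 1" using card_mono[of "{\<phi> i}"] by simp
    ultimately show False using ij by simp
  qed
  then show ?thesis using \<phi> by blast
qed

context
  fixes G :: "('a, 'b) monoid_scheme" and \<mu>
  assumes \<mu>: "invariant_fa_prob G \<mu>"
begin

lemma mean_Un:
  "\<lbrakk>A \<subseteq> carrier G; B \<subseteq> carrier G; A \<inter> B = {}\<rbrakk> \<Longrightarrow> \<mu> (A \<union> B) = \<mu> A + \<mu> B"
  using \<mu> by (simp add: invariant_fa_prob_def)

lemma mean_UN:
  assumes "finite I" "\<And>i. i \<in> I \<Longrightarrow> A i \<subseteq> carrier G"
    and "\<And>i j. \<lbrakk>i \<in> I; j \<in> I; i \<noteq> j\<rbrakk> \<Longrightarrow> A i \<inter> A j = {}"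
  shows "\<mu> (\<Union>i\<in>I. A i) = (\<Sum>i\<in>I. \<mu> (A i))"
  using assms
proof (induction I rule: finite_induct)
  case empty
  show ?case using mean_Un[of "{}" "{}"] by simp
next
  case (insert i I)
  have "\<mu> (A i \<union> (\<Union>i\<in>I. A i)) = \<mu> (A i) + \<mu> (\<Union>i\<in>I. A i)"
  proof (rule mean_Un)
    show "A i \<inter> (\<Union>i\<in>I. A i) = {}"
      using insert.hyps insert.prems(2)[of i] by auto
  qed (use insert.prems in auto)
  then show ?case using insert by simp
qed

lemma mean_le_1:
  assumes "A \<subseteq> carrier G"
  shows "\<mu> A \<le> 1"
proof -
  have "\<mu> (A \<union> (carrier G - A)) = \<mu> A + \<mu> (carrier G - A)"
    using assms by (intro mean_Un) auto
  moreover have "A \<union> (carrier G - A) = carrier G" using assms by auto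
  moreover have "\<mu> (carrier G - A) \<ge> 0" "\<mu> (carrier G) = 1"
    using \<mu> by (auto simp: invariant_fa_prob_def)
  ultimately show ?thesis by simp
qed

end

text \<open>
  Hall's theorem gives an injection of two copies of \<open>G\<close> into \<open>G\<close> that moves every element by
  left multiplication with some \<open>s \<in> S\<close>. Splitting each copy according to the \<open>s\<close> that is used, the
  pieces of total mean 2 are translated to disjoint subsets of \<open>G\<close>.
\<close>

lemma (in group) doubling_not_amenable:
  assumes S: "finite S" "S \<subseteq> carrier G"
    and doubling: "\<And>F. finite F \<Longrightarrow> F \<subseteq> carrier G \<Longrightarrow> 2 * card F \<le> card (S <#> F)"
  shows "\<not> amenable_group G"
proof
  assume "amenable_group G"
  then obtain \<mu> where \<mu>: "invariant_fa_prob G \<mu>" by (auto simp: amenable_group_def)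
  define J where "J = carrier G \<times> (UNIV :: bool set)"
  have "\<exists>\<phi>. inj_on \<phi> J \<and> (\<forall>j\<in>J. \<phi> j \<in> (\<lambda>s. s \<otimes> fst j) ` S)"
  proof (rule infinite_hall)
    show "finite ((\<lambda>s. s \<otimes> fst j) ` S)" for j :: "'a \<times> bool" using S by simp
  next
    fix F assume F: "finite F" "F \<subseteq> J"
    have "card F \<le> card (fst ` F \<times> (UNIV :: bool set))"
      using F by (intro card_mono finite_cartesian_product finite_imageI subsetI)
        (auto simp: mem_Times_iff)
    also have "\<dots> = 2 * card (fst ` F)" by (simp add: card_cartesian_product)
    also have "\<dots> \<le> card (S <#> fst ` F)" using F by (intro doubling) (auto simp: J_def)
    also have "S <#> fst ` F = (\<Union>j\<in>F. (\<lambda>s. s \<otimes> fst j) ` S)" by (auto simp: set_mult_def)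
    finally show "card F \<le> card (\<Union>j\<in>F. (\<lambda>s. s \<otimes> fst j) ` S)" .
  qed
  then obtain \<phi> where inj: "inj_on \<phi> J" and "\<forall>j\<in>J. \<exists>s\<in>S. \<phi> j = s \<otimes> fst j" by (auto simp: image_iff)
  then obtain \<sigma> where \<sigma>: "\<And>j. j \<in> J \<Longrightarrow> \<sigma> j \<in> S \<and> \<phi> j = \<sigma> j \<otimes> fst j" by metis
  define B where "B i s = {g \<in> carrier G. \<sigma> (g, i) = s}" for i s
  have B: "B i s \<subseteq> carrier G" for i s by (auto simp: B_def)
  have whole: "(\<Sum>s\<in>S. \<mu> (B i s)) = 1" for i
  proof -
    have "(\<Union>s\<in>S. B i s) = carrier G" using \<sigma> by (auto simp: B_def J_def)
    moreover have "\<mu> (\<Union>s\<in>S. B i s) = (\<Sum>s\<in>S. \<mu> (B i s))"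
      using S(1) by (intro mean_UN[OF \<mu>]) (auto simp: B_def)
    ultimately show ?thesis using \<mu> by (simp add: invariant_fa_prob_def)
  qed
  let ?I = "(UNIV :: bool set) \<times> S"
  have piece: "\<exists>g. g \<in> carrier G \<and> \<phi> (g, i) = y \<and> \<sigma> (g, i) = s" if y: "y \<in> s <# B i s" for i s y
  proof -
    obtain g where g: "g \<in> carrier G" "\<sigma> (g, i) = s" "y = s \<otimes> g"
      using y unfolding l_coset_def B_def by blast
    then show ?thesis using \<sigma>[of "(g, i)"] by (auto simp: J_def)
  qed
  have disj: "(s <# B i s) \<inter> (s' <# B i' s') = {}" if "(i, s) \<noteq> (i', s')" for i s i' s'
  proof (rule ccontr)
    assume "(s <# B i s) \<inter> (s' <# B i' s') \<noteq> {}"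
    then obtain y where "y \<in> s <# B i s" "y \<in> s' <# B i' s'" by auto
    then obtain g g' where "g \<in> carrier G" "\<phi> (g, i) = y" "\<sigma> (g, i) = s"
        "g' \<in> carrier G" "\<phi> (g', i') = y" "\<sigma> (g', i') = s'"
      by (meson piece)
    then show False using inj_onD[OF inj, of "(g, i)" "(g', i')"] that by (auto simp: J_def)
  qed
  have sub: "s <# B i s \<subseteq> carrier G" if "s \<in> S" for i s
    using that S B[of i s] by (auto simp: l_coset_def)
  have "2 = (\<Sum>i\<in>(UNIV :: bool set). \<Sum>s\<in>S. \<mu> (B i s))" by (simp add: whole)
  also have "\<dots> = (\<Sum>(i, s)\<in>?I. \<mu> (B i s))" by (simp add: sum.cartesian_product)
  also have "\<dots> = (\<Sum>(i, s)\<in>?I. \<mu> (s <# B i s))"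
    using \<mu> S B by (intro sum.cong) (auto simp: invariant_fa_prob_def)
  also have "\<dots> = (\<Sum>p\<in>?I. \<mu> (snd p <# B (fst p) (snd p)))" by (simp add: case_prod_unfold)
  also have "\<dots> = \<mu> (\<Union>p\<in>?I. snd p <# B (fst p) (snd p))"
  proof (rule mean_UN[OF \<mu>, symmetric])
    show "(snd p <# B (fst p) (snd p)) \<inter> (snd q <# B (fst q) (snd q)) = {}" if "p \<noteq> q" for p q
      using disj[of "fst p" "snd p" "fst q" "snd q"] that by simp
    show "(snd p <# B (fst p) (snd p)) \<subseteq> carrier G" if "p \<in> ?I" for p
      by (rule sub) (use that in auto)
    show "finite ?I" using S(1) by simp
  qed
  also have "\<dots> \<le> 1"
  proof (rule mean_le_1[OF \<mu>], rule UN_least)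
    show "(snd p <# B (fst p) (snd p)) \<subseteq> carrier G" if "p \<in> ?I" for p
      by (rule sub) (use that in auto)
  qed
  finally show False by simp
qed

lemma (in group) finite_amenable:
  assumes "finite (carrier G)"
  shows "amenable_group G"
proof -
  define \<mu> where "\<mu> A = real (card A) / real (card (carrier G))" for A :: "'a set"
  have "card (carrier G) > 0" using assms by (auto simp: card_gt_0_iff)
  then have "\<mu> (carrier G) = 1" by (simp add: \<mu>_def)
  moreover have "\<mu> (A \<union> B) = \<mu> A + \<mu> B" if "A \<subseteq> carrier G" "B \<subseteq> carrier G" "A \<inter> B = {}" for A B
    using that assms card_Un_disjoint[of A B] by (simp add: \<mu>_def add_divide_distrib finite_subset)
  moreover have "\<mu> (g <# A) = \<mu> A" if "g \<in> carrier G" "A \<subseteq> carrier G" for g A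
  proof -
    have "g <# A = (\<lambda>h. g \<otimes> h) ` A" by (auto simp: l_coset_def)
    moreover have "inj_on (\<lambda>h. g \<otimes> h) A" using inj_on_cmult[OF that(1)] that(2) by (rule inj_on_subset)
    ultimately show ?thesis by (simp add: \<mu>_def card_image)
  qed
  moreover have "0 \<le> \<mu> A" for A by (simp add: \<mu>_def)
  ultimately have "invariant_fa_prob G \<mu>" unfolding invariant_fa_prob_def by blast
  then show ?thesis using is_group by (auto simp: amenable_group_def)
qed

section \<open>Linear algebra over the field with two elements\<close>

text \<open>Addition of bits is kept as a group operation, so that sums can be manipulated as such.\<close>

declare add_bit_eq_xor [simp del]

lemma bit_add_self [simp]: "a + a = (0::bit)"
  by (cases a) (simp_all flip: mult_2)

lemma bit_add_eq_0_iff: "a + b = 0 \<longleftrightarrow> a = b" for a b :: bit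
  by (cases a; cases b) simp_all

lemma card_supported_functions:
  assumes "finite E"
  shows "card {c. \<forall>e. e \<notin> E \<longrightarrow> c e = (0::bit)} = 2 ^ card E"
    and "finite {c. \<forall>e. e \<notin> E \<longrightarrow> c e = (0::bit)}"
proof -
  let ?L = "{c. \<forall>e. e \<notin> E \<longrightarrow> c e = (0::bit)}"
  have bij: "bij_betw (\<lambda>c. {e. c e = 1}) ?L (Pow E)"
  proof (rule bij_betw_byWitness[where f' = "\<lambda>A e. if e \<in> A then 1 else 0"])
    show "\<forall>c\<in>?L. (\<lambda>e. if e \<in> {e. c e = 1} then 1 else 0) = c"
      by (auto simp: fun_eq_iff)
    show "(\<lambda>c. {e. c e = 1}) ` ?L \<subseteq> Pow E" by fastforce
  qed auto
  show "card ?L = 2 ^ card E" using bij_betw_same_card[OF bij] by (simp add: card_Pow assms)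
  show "finite ?L" using bij_betw_finite[OF bij] assms by simp
qed

text \<open>
  The fibres of the additive map \<open>h\<close> are translates of subsets of its kernel.
\<close>

lemma card_le_kernel_times_image:
  fixes h :: "('e \<Rightarrow> bit) \<Rightarrow> 't \<Rightarrow> bit"
  assumes fin: "finite A"
    and closed: "\<And>c d. c \<in> A \<Longrightarrow> d \<in> A \<Longrightarrow> (\<lambda>e. c e + d e) \<in> A"
    and h: "\<And>c d. h (\<lambda>e. c e + d e) = (\<lambda>t. h c t + h d t)"
    and im: "card (h ` A) \<le> k"
  shows "card A \<le> card {c \<in> A. \<forall>t. h c t = 0} * k"
proof -
  let ?K = "{c \<in> A. \<forall>t. h c t = 0}"
  have fibre: "card {c \<in> A. h c = b} \<le> card ?K" if b: "b \<in> h ` A" for b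
  proof -
    obtain d where d: "d \<in> A" "h d = b" using b by auto
    have "inj_on (\<lambda>c e. c e + d e) {c \<in> A. h c = b}"
      by (rule inj_onI) (simp add: fun_eq_iff)
    moreover have "(\<lambda>c e. c e + d e) ` {c \<in> A. h c = b} \<subseteq> ?K"
      using closed d h by auto
    ultimately show ?thesis using fin by (intro card_inj_on_le) auto
  qed
  have "A = (\<Union>b\<in>h ` A. {c \<in> A. h c = b})" by auto
  then have "card A \<le> (\<Sum>b\<in>h ` A. card {c \<in> A. h c = b})"
    using card_UN_le[of "h ` A" "\<lambda>b. {c \<in> A. h c = b}"] fin by simp
  also have "\<dots> \<le> (\<Sum>b\<in>h ` A. card ?K)" using fibre by (rule sum_mono)
  also have "\<dots> \<le> card ?K * k" using im by (simp add: mult.commute)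
  finally show ?thesis .
qed

text \<open>
  A subspace \<open>D\<close> of dimension \<open>d\<close> projects onto some \<open>d\<close> coordinates. The set \<open>I\<close> is chosen
  maximal with the property that \<open>D\<close> projects onto it. A vector in \<open>D\<close> that vanishes on \<open>I\<close>, but
  not at a coordinate \<open>e\<close>, could be used to correct values at \<open>e\<close> and to enlarge \<open>I\<close>; so the
  projection is also injective.
\<close>

lemma information_set:
  fixes D :: "('e \<Rightarrow> bit) set"
  assumes E: "finite E" and supp: "\<And>d e. d \<in> D \<Longrightarrow> e \<notin> E \<Longrightarrow> d e = 0"
    and zero: "(\<lambda>_. 0) \<in> D"
    and closed: "\<And>c d. c \<in> D \<Longrightarrow> d \<in> D \<Longrightarrow> (\<lambda>e. c e + d e) \<in> D"
  obtains I where "I \<subseteq> E" "card D \<le> 2 ^ card I" "\<And>g. \<exists>d\<in>D. \<forall>i\<in>I. d i = g i"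
proof -
  define \<I> where "\<I> = {I \<in> Pow E. \<forall>g. \<exists>d\<in>D. \<forall>i\<in>I. d i = g i}"
  have "finite \<I>" using E by (simp add: \<I>_def)
  moreover have "{} \<in> \<I>" using zero by (auto simp: \<I>_def)
  ultimately obtain I where I: "I \<in> \<I>" and max: "\<And>J. J \<in> \<I> \<Longrightarrow> I \<subseteq> J \<Longrightarrow> I = J"
    using finite_has_maximal[of \<I>] by blast
  have onto: "\<exists>d\<in>D. \<forall>i\<in>I. d i = g i" for g using I by (auto simp: \<I>_def)
  have IE: "I \<subseteq> E" using I by (auto simp: \<I>_def)
  have kernel: "d = (\<lambda>_. 0)" if d: "d \<in> D" "\<And>i. i \<in> I \<Longrightarrow> d i = 0" for d
  proof (rule ccontr)
    assume "d \<noteq> (\<lambda>_. 0)"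
    then obtain e where e: "d e = 1" by (auto simp: fun_eq_iff)
    have "\<exists>d'\<in>D. \<forall>i\<in>insert e I. d' i = g i" for g
    proof -
      obtain d1 where d1: "d1 \<in> D" "\<forall>i\<in>I. d1 i = g i" using onto by blast
      show ?thesis
      proof (cases "d1 e = g e")
        case False
        then have "d1 e + d e = g e" using e by (cases "d1 e"; cases "g e") simp_all
        then show ?thesis using d1 d closed by (intro bexI[of _ "\<lambda>e. d1 e + d e"]) auto
      qed (use d1 in auto)
    qed
    moreover have "e \<in> E" using supp[OF d(1), of e] e by fastforce
    ultimately have "insert e I \<in> \<I>" using IE by (auto simp: \<I>_def)
    then have "e \<in> I" using max[of "insert e I"] by blast
    then show False using d(2) e by fastforce
  qed
  have "inj_on (\<lambda>d. {i \<in> I. d i = 1}) D"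
  proof (rule inj_onI)
    fix c d assume cd: "c \<in> D" "d \<in> D" "{i \<in> I. c i = 1} = {i \<in> I. d i = 1}"
    then have "c i = d i" if "i \<in> I" for i
      using that by (cases "c i"; cases "d i") force+
    then have "(\<lambda>e. c e + d e) = (\<lambda>_. 0)" using cd closed by (intro kernel) auto
    then show "c = d" by (auto simp: fun_eq_iff bit_add_eq_0_iff)
  qed
  then have "card D \<le> card (Pow I)"
    using IE E finite_subset by (intro card_inj_on_le) auto
  also have "\<dots> = 2 ^ card I" using finite_subset[OF IE E] by (rule card_Pow)
  finally show thesis using that IE onto by blast
qed

section \<open>Words, relators and path sums\<close>

definition word_power :: "nat \<Rightarrow> 'a list \<Rightarrow> 'a list"
  where "word_power n w = concat (replicate n w)"

lemma word_power_0 [simp]: "word_power 0 w = []"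
  and word_power_Suc [simp]: "word_power (Suc n) w = w @ word_power n w"
  by (simp_all add: word_power_def)

lemma word_power_add: "word_power (m + n) w = word_power m w @ word_power n w"
  by (induction m) simp_all

lemma word_power_commute: "word_power n w @ w = w @ word_power n w"
  by (induction n) simp_all

text \<open>
  The reciprocals of the exponents sum to at most 1 as the words are enumerated by \<open>to_nat\<close>. All
  exponents are powers of 2, the characteristic of the coefficients: this makes short orbits
  contribute nothing in \<open>card_relator_sums_le\<close>.
\<close>

definition relator_exponent :: "'a::finite list \<Rightarrow> nat"
  where "relator_exponent w = 2 ^ Suc (to_nat w)"

lemma relator_exponent_pos: "0 < relator_exponent w"
  by (simp add: relator_exponent_def)

text \<open>
  The vertices of the graph are the values of \<open>\<kappa>\<close>, and an edge \<open>(x, \<kappa> t)\<close> leads from \<open>\<kappa> t\<close> to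
  \<open>\<kappa> (x # t)\<close>. A word is read from right to left, so that it acts on vertices by left
  multiplication; the edges visited are those of the path that spells \<open>w\<close> from the vertex \<open>\<kappa> t\<close>.
\<close>

primrec path_sum :: "('a list \<Rightarrow> 'v) \<Rightarrow> ('a \<times> 'v \<Rightarrow> bit) \<Rightarrow> 'a list \<Rightarrow> 'a list \<Rightarrow> bit" where
  "path_sum \<kappa> c [] t = 0"
| "path_sum \<kappa> c (x # w) t = path_sum \<kappa> c w t + c (x, \<kappa> (w @ t))"

lemma path_sum_append: "path_sum \<kappa> c (u @ v) t = path_sum \<kappa> c v t + path_sum \<kappa> c u (v @ t)"
  by (induction u) (simp_all add: add_ac)

lemma path_sum_zero: "path_sum \<kappa> (\<lambda>_. 0) w t = 0"
  by (induction w) simp_all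

lemma path_sum_add:
  "path_sum \<kappa> (\<lambda>e. c e + d e) w t = path_sum \<kappa> c w t + path_sum \<kappa> d w t"
  by (induction w) (simp_all add: add_ac)

section \<open>Finite quotients in which all relators hold\<close>

lemma finite_range_factor:
  assumes "finite (range g)" and factor: "\<And>u v. g u = g v \<Longrightarrow> f u = f v"
  shows "finite (range f)"
proof -
  have "f u = f (inv_into UNIV g (g u))" for u
    by (rule factor) (simp add: f_inv_into_f)
  then have "range f \<subseteq> (\<lambda>q. f (inv_into UNIV g q)) ` range g" by blast
  then show ?thesis using assms(1) finite_surj by blast
qed

text \<open>
  The finite quotients of the free monoid that satisfy the relators are given by their kernel
  congruences, so that the quotients of all sizes live in one type. The vertex of the Cayley graph
  that belongs to a word \<open>u\<close> is the class \<open>r u\<close>, written as a predicate. Such a quotient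
  is a group: \<open>w\<close> has the inverse \<open>w\<^sup>e\<^sup>(\<^sup>w\<^sup>)\<^sup>-\<^sup>1\<close>.
\<close>

locale torsion_congruence =
  fixes r :: "'a::finite list \<Rightarrow> 'a list \<Rightarrow> bool"
  assumes equivp: "equivp r"
    and append_cong: "\<lbrakk>r u u'; r v v'\<rbrakk> \<Longrightarrow> r (u @ v) (u' @ v')"
    and finite_classes: "finite (range r)"
    and relator: "r (word_power (relator_exponent w) w) []"
begin

lemma related_iff: "r u v \<longleftrightarrow> r u = r v"
  using equivp by (simp add: equivp_def)

lemma class_append: "\<lbrakk>r u = r u'; r v = r v'\<rbrakk> \<Longrightarrow> r (u @ v) = r (u' @ v')"
  using append_cong[of u u' v v'] by (simp only: related_iff)

lemma class_relator: "r (word_power (relator_exponent w) w) = r []"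
  using relator by (simp only: related_iff)

lemma class_inverse: "\<exists>v. r (u @ v) = r [] \<and> r (v @ u) = r []"
proof -
  obtain n where "relator_exponent u = Suc n"
    using relator_exponent_pos gr0_implies_Suc by blast
  then have "r (u @ word_power n u) = r []" using class_relator[of u] by simp
  then show ?thesis by (metis word_power_commute)
qed

lemma class_cancel_right: "r (u @ t) = r (v @ t) \<Longrightarrow> r u = r v"
proof -
  assume eq: "r (u @ t) = r (v @ t)"
  obtain s where s: "r (t @ s) = r []" using class_inverse by blast
  have "r (u @ t @ s) = r (v @ t @ s)" using class_append[OF eq refl, of s] by simp
  moreover have "r (w @ t @ s) = r w" for w using class_append[OF refl s, of w] by simp
  ultimately show ?thesis by simp
qed

lemma class_powers_multiple:
  assumes "r (word_power m w) = r []"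
  shows "r (word_power (m * k) w) = r []"
proof (induction k)
  case (Suc k)
  then show ?case using class_append[OF assms Suc] by (simp add: word_power_add)
qed simp

lemma path_sum_class: "r t = r t' \<Longrightarrow> path_sum r c w t = path_sum r c w t'"
  by (induction w) (auto intro: arg_cong[OF class_append])

definition "edges = (UNIV :: 'a set) \<times> range r"
definition "labels = {c. \<forall>e. e \<notin> edges \<longrightarrow> c e = (0::bit)}"
definition "balanced = {c \<in> labels. \<forall>w t. path_sum r c (word_power (relator_exponent w) w) t = 0}"

lemma finite_edges: "finite edges"
  using finite_classes by (simp add: edges_def)

lemma card_edges: "card edges = card (UNIV :: 'a set) * card (range r)"
  by (simp add: edges_def card_cartesian_product)

end

section \<open>Counting balanced labellings\<close>

lemma sum_div_powers_of_2_le: "(\<Sum>i<N. m div 2 ^ Suc i) \<le> (m::nat)"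
proof -
  have "(\<Sum>i<N. m div 2 ^ Suc i) + m div 2 ^ N \<le> m"
  proof (induction N)
    case (Suc N)
    have "m div 2 ^ Suc N = (m div 2 ^ N) div 2"
      by (metis div_mult2_eq power_Suc2)
    then have "2 * (m div 2 ^ Suc N) \<le> m div 2 ^ N" by simp
    then show ?case using Suc by simp
  qed simp
  then show ?thesis by simp
qed

lemma sum_div_relator_exponent_le:
  assumes "finite V"
  shows "(\<Sum>w\<in>V. m div relator_exponent w) \<le> m"
proof -
  obtain N where N: "to_nat ` V \<subseteq> {..<N}"
    using assms finite_nat_set_iff_bounded[of "to_nat ` V"] by auto
  have "(\<Sum>w\<in>V. m div relator_exponent w) = (\<Sum>i\<in>to_nat ` V. m div 2 ^ Suc i)"
    by (simp add: sum.reindex relator_exponent_def)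
  also have "\<dots> \<le> (\<Sum>i<N. m div 2 ^ Suc i)" using N by (intro sum_mono2) auto
  also have "\<dots> \<le> m" by (rule sum_div_powers_of_2_le)
  finally show ?thesis .
qed

context torsion_congruence
begin

text \<open>
  The order of \<open>w\<close> divides \<open>2\<^sup>k\<^sup>+\<^sup>1\<close> but not \<open>2\<^sup>k\<close>, so it is \<open>2\<^sup>k\<^sup>+\<^sup>1\<close>.
\<close>

lemma two_power_le_exponent:
  assumes half: "r (word_power (2 ^ k) w) \<noteq> r []"
    and full: "r (word_power (2 ^ Suc k) w) = r []"
    and l: "r (word_power l w) = r []" "0 < l"
  shows "2 ^ Suc k \<le> l"
proof (rule ccontr)
  assume "\<not> 2 ^ Suc k \<le> l"
  obtain x y where xy: "l * x = 2 ^ Suc k * y + gcd l (2 ^ Suc k)"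
    using bezout_nat[of l "2 ^ Suc k"] l(2) by auto
  have "gcd l (2 ^ Suc k) dvd 2 ^ Suc k" by simp
  then obtain a where a: "a \<le> Suc k" "gcd l (2 ^ Suc k) = 2 ^ a"
    using divides_primepow_nat[OF two_is_prime_nat] by blast
  have "gcd l (2 ^ Suc k) \<le> l" using l(2) by (simp add: dvd_imp_le)
  then have "a \<noteq> Suc k" using a \<open>\<not> 2 ^ Suc k \<le> l\<close> by auto
  then have "a \<le> k" using a by simp
  have "r (word_power (2 ^ Suc k * y) w @ word_power (2 ^ a) w) = r []"
    using class_powers_multiple[OF l(1), of x] xy a by (simp add: word_power_add)
  moreover have "r (word_power (2 ^ Suc k * y) w @ word_power (2 ^ a) w) = r (word_power (2 ^ a) w)"
    using class_append[OF class_powers_multiple[OF full, of y] refl] by simp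
  ultimately have "r (word_power (2 ^ a) w) = r []" by simp
  then have "r (word_power (2 ^ a * 2 ^ (k - a)) w) = r []" by (rule class_powers_multiple)
  then show False using half \<open>a \<le> k\<close> by (simp flip: power_add)
qed

text \<open>
  The path sum of the relator \<open>w\<^sup>e\<close> is \<open>\<Sum>j<e. f (w\<^sup>j t)\<close>, where \<open>f\<close> is the path sum of \<open>w\<close>. If the
  order of \<open>w\<close> is a proper divisor of \<open>e\<close>, it divides \<open>e / 2\<close>, and the two halves of the sum
  cancel. Otherwise all \<open>w\<close>-orbits have length \<open>e\<close>, and the sum, being constant on each of
  them, is one of \<open>2\<^sup>m\<^sup>/\<^sup>e\<close> functions.
\<close>

lemma card_relator_sums_le:
  "card ((\<lambda>c. path_sum r c (word_power (relator_exponent w) w)) ` A)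
     \<le> 2 ^ (card (range r) div relator_exponent w)"
proof -
  define n where "n = relator_exponent w"
  define h where "h c = path_sum r c (word_power n w)" for c
  obtain k where k: "n = 2 ^ Suc k" by (auto simp: n_def relator_exponent_def)
  have full: "r (word_power n w) = r []" using class_relator by (simp add: n_def)
  have "card (h ` A) \<le> 2 ^ (card (range r) div n)"
  proof (cases "r (word_power (2 ^ k) w) = r []")
    case True
    have "h c t = 0" for c t
    proof -
      have "word_power n w = word_power (2 ^ k) w @ word_power (2 ^ k) w"
        by (simp add: k mult_2 word_power_add)
      then show ?thesis
        using class_append[OF True refl, of t] path_sum_class[of "word_power (2 ^ k) w @ t" t]
        by (simp add: h_def path_sum_append)
    qed
    then have "h ` A \<subseteq> {\<lambda>_. 0}" by auto
    then have "card (h ` A) \<le> 1" using card_mono[of "{\<lambda>_. 0}" "h ` A"] by simp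
    then show ?thesis by (simp add: order.trans[OF _ one_le_power])
  next
    case False
    define orb where "orb t = range (\<lambda>j. r (word_power j w @ t))" for t
    have self: "r t \<in> orb t" for t by (auto simp: orb_def intro: range_eqI[of _ _ 0])
    have orb_sub: "orb t \<subseteq> orb t'" if t: "r t \<in> orb t'" for t t'
    proof -
      obtain j where j: "r t = r (word_power j w @ t')" using t by (auto simp: orb_def)
      have "r (word_power i w @ t) = r (word_power (i + j) w @ t')" for i
        using class_append[OF refl j, of "word_power i w"] by (simp add: word_power_add)
      then show ?thesis by (auto simp: orb_def)
    qed
    have orb_sym: "r t' \<in> orb t" if t: "r t \<in> orb t'" for t t'
    proof -
      obtain j where j: "r t = r (word_power j w @ t')" using t by (auto simp: orb_def)
      define l where "l = j * (n - 1)"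
      have l: "l + j = n * j" by (cases n) (simp_all add: l_def k)
      have "r (word_power l w @ t) = r (word_power l w @ word_power j w @ t')"
        using class_append[OF refl j] .
      also have "word_power l w @ word_power j w @ t' = word_power (n * j) w @ t'"
        by (simp flip: l add: word_power_add)
      also have "r \<dots> = r t'"
        using class_append[OF class_powers_multiple[OF full, of j] refl, of t'] by simp
      finally show ?thesis unfolding orb_def by (metis rangeI)
    qed
    have orb_eq: "orb t = orb t'" if common: "orb t \<inter> orb t' \<noteq> {}" for t t'
    proof -
      obtain s where s: "r s \<in> orb t" "r s \<in> orb t'" using common by (force simp: orb_def)
      have "orb s = orb t" "orb s = orb t'"
        using orb_sub[OF s(1)] orb_sub[OF orb_sym[OF s(1)]]
          orb_sub[OF s(2)] orb_sub[OF orb_sym[OF s(2)]] by auto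
      then show ?thesis by simp
    qed
    have card_orb: "card (orb t) = n" for t
    proof -
      have "orb t = (\<lambda>j. r (word_power j w @ t)) ` {..<n}"
      proof -
        have "r (word_power j w @ t) = r (word_power (j mod n) w @ t)" for j
        proof -
          have "r (word_power (n * (j div n)) w @ word_power (j mod n) w @ t) = r (word_power (j mod n) w @ t)"
            using class_append[OF class_powers_multiple[OF full, of "j div n"] refl] by simp
          moreover have "word_power j w = word_power (n * (j div n)) w @ word_power (j mod n) w"
            by (simp flip: word_power_add)
          ultimately show ?thesis by simp
        qed
        moreover have "j mod n < n" for j using k by simp
        ultimately show ?thesis unfolding orb_def by blast
      qed
      moreover have "inj_on (\<lambda>j. r (word_power j w @ t)) {..<n}"
      proof (rule linorder_inj_onI)
        fix i j assume ij: "i < j" "i \<in> {..<n}" "j \<in> {..<n}"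
        show "r (word_power i w @ t) \<noteq> r (word_power j w @ t)"
        proof
          assume "r (word_power i w @ t) = r (word_power j w @ t)"
          then have "r (word_power i w) = r (word_power j w)" by (rule class_cancel_right)
          moreover have "word_power j w = word_power (j - i) w @ word_power i w"
            using ij by (simp flip: word_power_add)
          ultimately have "r (word_power (j - i) w @ word_power i w) = r ([] @ word_power i w)"
            by (metis append_Nil)
          then have "r (word_power (j - i) w) = r []" by (rule class_cancel_right)
          then have "n \<le> j - i"
            using two_power_le_exponent[OF False] full ij k by simp
          then show False using ij by simp
        qed
      qed auto
      ultimately show ?thesis by (simp add: card_image)
    qed
    have sub: "range orb \<subseteq> Pow (range r)" by (auto simp: orb_def)
    have fin: "finite (range orb)" using sub finite_classes by (meson finite_Pow_iff finite_subset)
    have Un: "\<Union>(range orb) = range r" using sub self by blast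
    have "n * card (range orb) = card (\<Union>(range orb))"
    proof (rule card_partition)
      show "finite (\<Union>(range orb))" using Un finite_classes by simp
    qed (use fin card_orb orb_eq in blast)+
    then have number: "card (range orb) = card (range r) div n"
      using Un k by (metis nonzero_mult_div_cancel_left power_not_zero zero_neq_numeral)
    have invariant: "h c (word_power j w @ t) = h c t" for c j t
    proof (induction j)
      case (Suc j)
      let ?s = "word_power j w @ t"
      have "path_sum r c (word_power n w @ w) ?s = path_sum r c (w @ word_power n w) ?s"
        by (simp add: word_power_commute)
      moreover have "path_sum r c w (word_power n w @ ?s) = path_sum r c w ?s"
        using path_sum_class class_append[OF full refl, of ?s] by (metis append_Nil)
      ultimately have "h c (w @ ?s) = h c ?s" by (simp add: h_def path_sum_append add.commute)
      then show ?case using Suc by simp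
    qed simp
    have orb_const: "h c t = h c t'" if t: "r t \<in> orb t'" for c t t'
    proof -
      obtain j where "r t = r (word_power j w @ t')" using t by (auto simp: orb_def)
      then have "h c t = h c (word_power j w @ t')" unfolding h_def by (rule path_sum_class)
      then show ?thesis by (simp add: invariant)
    qed
    have recover: "h c t = 1 \<longleftrightarrow> orb t \<in> {orb t' |t'. h c t' = 1}" for c t
    proof
      assume "orb t \<in> {orb t' |t'. h c t' = 1}"
      then obtain t' where t': "orb t = orb t'" "h c t' = 1" by blast
      then show "h c t = 1" using orb_const[of t t' c] self[of t] by simp
    qed blast
    have "inj_on (\<lambda>f. {orb t |t. f t = 1}) (h ` A)"
    proof (rule inj_onI)
      fix f g assume fg: "f \<in> h ` A" "g \<in> h ` A" and eq: "{orb t |t. f t = 1} = {orb t |t. g t = 1}"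
      obtain c d where cd: "f = h c" "g = h d" using fg by auto
      have "f t = 1 \<longleftrightarrow> g t = 1" for t
        unfolding cd recover[of c t] recover[of d t] using eq by (simp only: cd)
      then show "f = g" by (metis (full_types) bit_not_one_iff ext)
    qed
    then have "card (h ` A) \<le> card (Pow (range orb))"
      using fin by (intro card_inj_on_le) auto
    then show ?thesis using fin by (simp add: card_Pow number)
  qed
  then show ?thesis by (simp add: h_def n_def)
qed

lemma labels_add: "c \<in> labels \<Longrightarrow> d \<in> labels \<Longrightarrow> (\<lambda>e. c e + d e) \<in> labels"
  by (simp add: labels_def)

lemma finite_labels: "finite labels" and card_labels: "card labels = 2 ^ card edges"
  unfolding labels_def using card_supported_functions[OF finite_edges] by auto

text \<open>
  Finitely many relators suffice to define the balanced labellings, as there are only finitely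
  many labellings. Imposing the relator of \<open>w\<close> divides the number of labellings by at most
  \<open>2\<^sup>m\<^sup>/\<^sup>e\<^sup>(\<^sup>w\<^sup>)\<close>, and the exponents \<open>m / e(w)\<close> sum to at most \<open>m\<close>.
\<close>

lemma labellings_le_balanced:
  "2 ^ card edges \<le> card balanced * 2 ^ card (range r)"
proof -
  define bal where "bal V = {c \<in> labels. \<forall>w\<in>V. \<forall>t. path_sum r c (word_power (relator_exponent w) w) t = 0}" for V
  let ?f = "\<lambda>w. card (range r) div relator_exponent w"
  have bal: "2 ^ card edges \<le> card (bal V) * 2 ^ (\<Sum>w\<in>V. ?f w)" if "finite V" for V
    using that
  proof (induction V rule: finite_induct)
    case empty
    show ?case by (simp add: bal_def card_labels)
  next
    case (insert w V)
    have "card (bal V) \<le> card {c \<in> bal V. \<forall>t. path_sum r c (word_power (relator_exponent w) w) t = 0}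
        * 2 ^ ?f w"
    proof (rule card_le_kernel_times_image[OF _ _ _ card_relator_sums_le])
      show "finite (bal V)" using finite_labels by (simp add: bal_def)
    qed (auto simp: bal_def labels_add path_sum_add)
    also have "{c \<in> bal V. \<forall>t. path_sum r c (word_power (relator_exponent w) w) t = 0} = bal (insert w V)"
      by (auto simp: bal_def)
    finally have "card (bal V) * 2 ^ (\<Sum>w\<in>V. ?f w)
        \<le> card (bal (insert w V)) * 2 ^ ?f w * 2 ^ (\<Sum>w\<in>V. ?f w)" by simp
    then have "card (bal V) * 2 ^ (\<Sum>w\<in>V. ?f w) \<le> card (bal (insert w V)) * 2 ^ (\<Sum>w\<in>insert w V. ?f w)"
      using insert by (simp add: power_add mult.assoc)
    then show ?case using insert by (meson order.trans)
  qed
  \<comment> \<open>one violated relator for each labelling that is not balanced\<close>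
  define viol where "viol c = (SOME w. \<exists>t. path_sum r c (word_power (relator_exponent w) w) t \<noteq> 0)" for c
  define V where "V = viol ` labels"
  have V: "finite V" using finite_labels by (simp add: V_def)
  have "bal V \<subseteq> balanced"
  proof
    fix c assume c: "c \<in> bal V"
    show "c \<in> balanced"
    proof (rule ccontr)
      assume "c \<notin> balanced"
      moreover have lab: "c \<in> labels" using c by (simp add: bal_def)
      ultimately have "\<exists>w t. path_sum r c (word_power (relator_exponent w) w) t \<noteq> 0"
        by (auto simp: balanced_def)
      then have "\<exists>t. path_sum r c (word_power (relator_exponent (viol c)) (viol c)) t \<noteq> 0"
        unfolding viol_def by (rule someI_ex)
      moreover have "viol c \<in> V" using lab by (simp add: V_def)
      ultimately show False using c unfolding bal_def by blast
    qed
  qed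
  then have "card (bal V) \<le> card balanced"
    using finite_labels by (intro card_mono) (auto simp: balanced_def)
  moreover have "(2::nat) ^ (\<Sum>w\<in>V. ?f w) \<le> 2 ^ card (range r)"
    using sum_div_relator_exponent_le[OF V] by simp
  ultimately show ?thesis using bal[OF V] by (meson mult_le_mono order.trans)
qed

text \<open>
  This is the kernel congruence of the double cover \<open>Q \<times> \<int>/2\<close>, on which a word \<open>u\<close> sends
  \<open>(r t, a)\<close> to \<open>(r (u @ t), a + path_sum r c u t)\<close>. The relators act trivially on the cover exactly
  because \<open>c\<close> is balanced.
\<close>

lemma skew_product:
  assumes c: "c \<in> balanced"
  shows "torsion_congruence (\<lambda>u v. r u v \<and> path_sum r c u = path_sum r c v)" (is "torsion_congruence ?s")
proof
  show "equivp ?s"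
    using equivp by (auto intro!: equivpI reflpI sympI transpI elim: equivp_reflp equivp_symp equivp_transp)
  show "?s (u @ v) (u' @ v')" if "?s u u'" "?s v v'" for u u' v v'
  proof
    show "r (u @ v) (u' @ v')" using that append_cong by blast
    have "r (v @ t) = r (v' @ t)" for t using that class_append[of v v' t t] by (simp only: related_iff)
    then have "path_sum r c u (v @ t) = path_sum r c u (v' @ t)" for t by (rule path_sum_class)
    then show "path_sum r c (u @ v) = path_sum r c (u' @ v')"
      using that by (simp add: fun_eq_iff path_sum_append)
  qed
  show "?s (word_power (relator_exponent w) w) []" for w
    using c relator by (auto simp: balanced_def fun_eq_iff)
  \<comment> \<open>path sums depend on their starting point only through its class, so finitely many bits determine them\<close>
  let ?rep = "inv_into UNIV r"
  let ?code = "\<lambda>u. (r u, {q \<in> range r. path_sum r c u (?rep q) = 1})"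
  have rep: "r (?rep (r t)) = r t" for t by (simp add: f_inv_into_f)
  have path_rep: "path_sum r c u t = path_sum r c u (?rep (r t))" for u t
    by (rule path_sum_class) (simp add: rep)
  have code: "path_sum r c u = path_sum r c v" if "?code u = ?code v" for u v
  proof
    fix t
    have "path_sum r c u (?rep (r t)) = 1 \<longleftrightarrow> path_sum r c v (?rep (r t)) = 1"
      using that by (auto simp: set_eq_iff)
    then show "path_sum r c u t = path_sum r c v t"
      using path_rep by (metis (full_types) bit_not_one_iff)
  qed
  show "finite (range ?s)"
  proof (rule finite_range_factor)
    show "finite (range ?code)"
    proof (rule finite_subset)
      show "range ?code \<subseteq> range r \<times> Pow (range r)" by auto
    qed (use finite_classes in simp)
    show "?s u = ?s v" if "?code u = ?code v" for u v
      using code[OF that] that by (auto simp: fun_eq_iff)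
  qed
qed

end

section \<open>The residually finite limit and its expansion\<close>

definition limit_congruence :: "'a::finite list \<Rightarrow> 'a list \<Rightarrow> bool"
  where "limit_congruence u v \<longleftrightarrow> (\<forall>r. torsion_congruence r \<longrightarrow> r u v)"

lemma equivp_limit_congruence: "equivp limit_congruence"
proof (rule equivpI)
  show "reflp limit_congruence"
    unfolding limit_congruence_def by (rule reflpI) (meson torsion_congruence.equivp equivp_reflp)
  show "symp limit_congruence"
    unfolding limit_congruence_def by (rule sympI) (meson torsion_congruence.equivp equivp_symp)
  show "transp limit_congruence"
    unfolding limit_congruence_def by (rule transpI) (meson torsion_congruence.equivp equivp_transp)
qed

lemma limit_class_eq_iff: "limit_congruence u = limit_congruence v \<longleftrightarrow> limit_congruence u v"
  using equivp_limit_congruence unfolding equivp_def by blast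

lemma limit_congruence_append:
  "limit_congruence u u' \<Longrightarrow> limit_congruence v v' \<Longrightarrow> limit_congruence (u @ v) (u' @ v')"
  unfolding limit_congruence_def by (meson torsion_congruence.append_cong)

lemma limit_congruence_relator:
  "limit_congruence (word_power (relator_exponent w) w) []"
  by (simp add: limit_congruence_def torsion_congruence.relator)

lemma torsion_congruence_trivial: "torsion_congruence (\<lambda>_ _. True)"
  by standard (auto intro!: equivpI reflpI sympI transpI)

lemma torsion_congruence_inf:
  assumes "torsion_congruence r" "torsion_congruence s"
  shows "torsion_congruence (\<lambda>u v. r u v \<and> s u v)"
proof -
  interpret r: torsion_congruence r by fact
  interpret s: torsion_congruence s by fact
  show ?thesis
  proof
    show "equivp (\<lambda>u v. r u v \<and> s u v)"
      using r.equivp s.equivp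
      by (auto intro!: equivpI reflpI sympI transpI elim: equivp_reflp equivp_symp equivp_transp)
    have "range (\<lambda>u v. r u v \<and> s u v) \<subseteq> (\<lambda>(p, q) v. p v \<and> q v) ` (range r \<times> range s)"
      by auto
    then show "finite (range (\<lambda>u v. r u v \<and> s u v))"
      using r.finite_classes s.finite_classes by (meson finite_SigmaI finite_imageI finite_subset)
  qed (auto intro: r.append_cong s.append_cong r.relator s.relator)
qed

text \<open>
  One congruence for each pair of words in \<open>F\<close> tells the pair apart; their intersection still has
  finitely many classes.
\<close>

lemma separate_words:
  assumes "finite F" and inj: "inj_on limit_congruence F"
  obtains r where "torsion_congruence r" "inj_on r F"
proof -
  have "\<exists>r. torsion_congruence r \<and> (\<forall>(u, v)\<in>P. \<not> r u v)"
    if "finite P" "\<And>u v. (u, v) \<in> P \<Longrightarrow> \<not> limit_congruence u v" for P :: "('a list \<times> 'a list) set"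
    using that
  proof (induction P rule: finite_induct)
    case empty
    then show ?case using torsion_congruence_trivial by auto
  next
    case (insert p P)
    obtain u v where p: "p = (u, v)" by fastforce
    obtain r where r: "torsion_congruence r" "\<forall>(u, v)\<in>P. \<not> r u v"
      using insert by blast
    obtain s where s: "torsion_congruence s" "\<not> s u v"
      using insert.prems[of u v] p by (auto simp: limit_congruence_def)
    show ?case
      by (rule exI[of _ "\<lambda>u v. r u v \<and> s u v"])
        (use r s p in \<open>auto intro: torsion_congruence_inf\<close>)
  qed
  moreover have "finite {(u, v) \<in> F \<times> F. u \<noteq> v}"
    using \<open>finite F\<close> by (auto intro: finite_subset[of _ "F \<times> F"])
  moreover have "\<not> limit_congruence u v" if "(u, v) \<in> {(u, v) \<in> F \<times> F. u \<noteq> v}" for u v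
    using that inj by (auto simp flip: limit_class_eq_iff dest: inj_onD)
  ultimately obtain r where r: "torsion_congruence r"
    and sep: "\<forall>(u, v)\<in>{(u, v) \<in> F \<times> F. u \<noteq> v}. \<not> r u v"
    by blast
  have "inj_on r F"
  proof (rule inj_onI, rule ccontr)
    fix u v assume uv: "u \<in> F" "v \<in> F" "r u = r v" "u \<noteq> v"
    then have "r u v" using torsion_congruence.related_iff[OF r] by blast
    then show False using sep uv by blast
  qed
  with r show thesis using that by blast
qed

text \<open>
  In terms of the finite quotient \<open>Q\<close> of order \<open>m\<close>, let \<open>I\<close> be a set of at least \<open>(n-1) m\<close> edges on
  which the balanced labellings take arbitrary values, and \<open>I_at t\<close> the part of \<open>I\<close> that starts in the
  translate \<open>F t\<close>. The value of \<open>c\<close> on the edge from \<open>f t\<close> to \<open>x f t\<close> is the difference of the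
  path sums of \<open>x # f\<close> and \<open>f\<close> from \<open>t\<close>, and these depend only on the classes of \<open>x # f\<close> and \<open>f\<close> in the
  limit. So the \<open>2\<^bsup>|I_at t|\<^esup>\<close> prescriptions on \<open>I_at t\<close> yield that many different functions on
  \<open>F \<union> X F\<close>. Since every edge of \<open>I\<close> starts in \<open>|F|\<close> translates, averaging over \<open>t\<close>
  gives the claim.
\<close>

lemma expansion:
  fixes F :: "'a::finite list set"
  assumes F: "finite F" and inj: "inj_on limit_congruence F"
  shows "(card (UNIV :: 'a set) - 1) * card F
    \<le> card (limit_congruence ` (F \<union> (\<lambda>(x, f). x # f) ` (UNIV \<times> F)))"
proof -
  obtain r where "torsion_congruence r" and inj_r: "inj_on r F" using separate_words[OF F inj] by blast
  interpret torsion_congruence r by fact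
  let ?U = "F \<union> (\<lambda>(x, f). x # f) ` (UNIV \<times> F)"
  let ?B = "limit_congruence ` ?U"
  let ?m = "card (range r)"
  have fin_B: "finite ?B" using F by simp
  have bal_add: "(\<lambda>e. c e + d e) \<in> balanced" if "c \<in> balanced" "d \<in> balanced" for c d
    using that by (simp add: balanced_def labels_add path_sum_add)
  obtain I where I: "I \<subseteq> edges" "card balanced \<le> 2 ^ card I"
      and onto: "\<And>g. \<exists>d\<in>balanced. \<forall>i\<in>I. d i = g i"
  proof (rule information_set[OF finite_edges _ _ bal_add])
    show "(\<lambda>_. 0) \<in> balanced" by (simp add: balanced_def labels_def path_sum_zero)
  qed (auto simp: balanced_def labels_def)
  have fin_I: "finite I" using I finite_edges finite_subset by blast
  have card_I: "(card (UNIV :: 'a set) - 1) * ?m \<le> card I"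
  proof -
    have "(2::nat) ^ card edges \<le> card balanced * 2 ^ ?m" by (rule labellings_le_balanced)
    also have "\<dots> \<le> 2 ^ card I * 2 ^ ?m" using I by simp
    finally have "(2::nat) ^ card edges \<le> 2 ^ (card I + ?m)" by (simp add: power_add)
    then have "card (UNIV :: 'a set) * ?m \<le> card I + ?m" by (simp add: card_edges)
    then show ?thesis by (simp add: algebra_simps)
  qed
  define rep where "rep = inv_into UNIV r"
  have rep: "r (rep (r t)) = r t" for t by (simp add: rep_def f_inv_into_f)
  define I_at where "I_at t = {e \<in> I. \<exists>f\<in>F. snd e = r (f @ t)}" for t
  have small: "card (I_at t) \<le> card ?B" for t
  proof -
    \<comment> \<open>a balanced labelling whose support meets \<open>I\<close> in \<open>A\<close>, and the support of its potential\<close>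
    define c where "c A = (SOME d. d \<in> balanced \<and> (\<forall>i\<in>I. d i = (if i \<in> A then 1 else 0)))" for A
    have c: "c A \<in> balanced" "i \<in> I \<Longrightarrow> c A i = (if i \<in> A then 1 else 0)" for A i
    proof -
      have "\<exists>d. d \<in> balanced \<and> (\<forall>i\<in>I. d i = (if i \<in> A then 1 else 0))"
        using onto[of "\<lambda>i. if i \<in> A then 1 else 0"] by blast
      then have "c A \<in> balanced \<and> (\<forall>i\<in>I. c A i = (if i \<in> A then 1 else 0))"
        unfolding c_def by (rule someI_ex)
      then show "c A \<in> balanced" "i \<in> I \<Longrightarrow> c A i = (if i \<in> A then 1 else 0)" by auto
    qed
    define p where "p A = limit_congruence ` {u \<in> ?U. path_sum r (c A) u t = 1}" for A
    have potential: "path_sum r (c A) u t = 1 \<longleftrightarrow> limit_congruence u \<in> p A" if "u \<in> ?U" for A u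
    proof
      assume "limit_congruence u \<in> p A"
      then obtain v where v: "limit_congruence u = limit_congruence v" "path_sum r (c A) v t = 1"
        by (auto simp: p_def)
      then have "path_sum r (c A) u = path_sum r (c A) v"
        using skew_product[OF c(1)[of A]] by (auto simp: limit_class_eq_iff limit_congruence_def)
      with v show "path_sum r (c A) u t = 1" by simp
    qed (use that in \<open>auto simp: p_def\<close>)
    have "inj_on p (Pow (I_at t))"
    proof (rule inj_onI)
      fix A A' assume A: "A \<in> Pow (I_at t)" "A' \<in> Pow (I_at t)" and eq: "p A = p A'"
      have path_eq: "path_sum r (c A) u t = path_sum r (c A') u t" if "u \<in> ?U" for u
        using potential[OF that, of A] potential[OF that, of A'] eq
        by (metis (full_types) bit_not_one_iff)
      have "e \<in> A \<longleftrightarrow> e \<in> A'" if at: "e \<in> I_at t" for e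
      proof -
        obtain x f where e: "e = (x, r (f @ t))" "f \<in> F" "e \<in> I"
          using at by (cases e) (auto simp: I_at_def)
        have "x # f \<in> ?U" "f \<in> ?U" using e by force+
        then have "c A e = c A' e" using path_eq[of "x # f"] path_eq[of f] e by simp
        then show ?thesis using c(2)[OF e(3)] by (auto split: if_splits)
      qed
      then show "A = A'" using A by blast
    qed
    then have "card (Pow (I_at t)) \<le> card (Pow ?B)"
      by (rule card_inj_on_le) (use fin_B in \<open>auto simp: p_def\<close>)
    moreover have "finite (I_at t)" using fin_I by (simp add: I_at_def)
    ultimately have "(2::nat) ^ card (I_at t) \<le> 2 ^ card ?B" using fin_B by (simp add: card_Pow)
    then show ?thesis by simp
  qed
  let ?P = "SIGMA q:range r. I_at (rep q)"
  have "card (I \<times> F) \<le> card ?P"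
  proof (rule card_inj_on_le)
    \<comment> \<open>the right translation that moves \<open>f\<close> to the vertex where \<open>e\<close> starts\<close>
    define tr where "tr e f = (SOME q. q \<in> range r \<and> snd e = r (f @ rep q))" for e :: "'a \<times> ('a list \<Rightarrow> bool)" and f
    have tr: "tr e f \<in> range r \<and> snd e = r (f @ rep (tr e f))" if e: "e \<in> I" for e f
    proof -
      obtain s where s: "snd e = r s" using e I by (auto simp: edges_def)
      obtain v where v: "r (f @ v) = r []" using class_inverse by blast
      have "r (f @ rep (r (v @ s))) = r (f @ v @ s)" by (intro class_append refl rep)
      also have "\<dots> = r s" using class_append[OF v refl, of s] by simp
      finally have "r (v @ s) \<in> range r \<and> snd e = r (f @ rep (r (v @ s)))" using s by simp
      then show ?thesis unfolding tr_def by (rule someI[of "\<lambda>q. q \<in> range r \<and> snd e = r (f @ rep q)"])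
    qed
    show "inj_on (\<lambda>(e, f). (tr e f, e)) (I \<times> F)"
    proof (rule inj_onI, clarsimp)
      fix e q f f' assume *: "(e, q) \<in> I" "f \<in> F" "f' \<in> F" "tr (e, q) f = tr (e, q) f'"
      then have "r (f @ rep (tr (e, q) f)) = r (f' @ rep (tr (e, q) f))"
        using tr[of "(e, q)" f] tr[of "(e, q)" f'] by simp
      then have "r f = r f'" by (rule class_cancel_right)
      then show "f = f'" using * inj_r by (auto dest: inj_onD)
    qed
    show "(\<lambda>(e, f). (tr e f, e)) ` (I \<times> F) \<subseteq> ?P" using tr by (auto simp: I_at_def) 
    show "finite ?P" using finite_classes fin_I by (auto simp: I_at_def)
  qed
  also have "card ?P = (\<Sum>q\<in>range r. card (I_at (rep q)))"
    using finite_classes fin_I by (simp add: card_SigmaI I_at_def)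
  also have "\<dots> \<le> (\<Sum>q\<in>range r. card ?B)" by (intro sum_mono small)
  finally have "card I * card F \<le> ?m * card ?B" by (simp add: card_cartesian_product)
  then have "(card (UNIV :: 'a set) - 1) * ?m * card F \<le> ?m * card ?B"
    using card_I mult_le_mono1 order.trans by blast
  then have "?m * ((card (UNIV :: 'a set) - 1) * card F) \<le> ?m * card ?B" by (simp only: mult_ac)
  moreover have "?m > 0" using finite_classes by (auto simp: card_gt_0_iff)
  ultimately show ?thesis by simp
qed

section \<open>The group on the natural numbers\<close>

text \<open>
  The code of a chosen representative stands for a class of words, which makes the carrier of the
  limit group a set of natural numbers.
\<close>

definition element :: "'a::finite list \<Rightarrow> nat"
  where "element u = to_nat (SOME v. limit_congruence u v)"

lemma limit_congruence_some: "limit_congruence u (SOME v. limit_congruence u v)"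
  using equivp_reflp[OF equivp_limit_congruence] by (rule someI)

lemma element_eq_iff: "element u = element v \<longleftrightarrow> limit_congruence u v"
proof
  assume "element u = element v"
  then have "(SOME w. limit_congruence u w) = (SOME w. limit_congruence v w)"
    by (simp add: element_def)
  then show "limit_congruence u v"
    using limit_congruence_some[of u] limit_congruence_some[of v]
    by (simp flip: limit_class_eq_iff)
next
  assume "limit_congruence u v"
  then have "limit_congruence u = limit_congruence v" by (simp only: limit_class_eq_iff)
  then show "element u = element v" by (simp only: element_def)
qed

lemma element_word: "limit_congruence (from_nat (element u)) u"
proof -
  have "from_nat (element u) = (SOME v. limit_congruence u v)" by (simp add: element_def)
  then show ?thesis using limit_congruence_some[of u] equivp_symp[OF equivp_limit_congruence] by metis
qed

lemma card_elements: "card (element ` U) = card (limit_congruence ` U)"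
proof -
  have "element ` U = (\<lambda>q. to_nat (SOME v. q v)) ` limit_congruence ` U"
    by (simp add: image_image element_def)
  moreover have "inj_on (\<lambda>q. to_nat (SOME v. q v)) (limit_congruence ` U)"
  proof (rule inj_onI)
    fix p q assume "p \<in> limit_congruence ` U" "q \<in> limit_congruence ` U"
      and eq: "to_nat (SOME v. p v) = to_nat (SOME v. q v)"
    then obtain u v where "p = limit_congruence u" "q = limit_congruence v" by auto
    then show "p = q"
      using eq element_eq_iff[of u v] limit_class_eq_iff[of u v] by (simp add: element_def)
  qed
  ultimately show ?thesis by (simp add: card_image)
qed

definition limit_group :: "'a::finite itself \<Rightarrow> nat monoid" where
  "limit_group _ =
     \<lparr>carrier = range (element :: 'a list \<Rightarrow> nat),
      monoid.mult = (\<lambda>a b. element (from_nat a @ from_nat b :: 'a list)),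
      one = element ([] :: 'a list)\<rparr>"

context
  fixes G :: "nat monoid" and T :: "'a::finite itself"
  defines "G \<equiv> limit_group T"
begin

lemma carrier_limit_group: "carrier G = range (element :: 'a list \<Rightarrow> nat)"
  by (simp add: G_def limit_group_def)

lemma one_limit_group: "\<one>\<^bsub>G\<^esub> = element ([] :: 'a list)"
  by (simp add: G_def limit_group_def)

lemma mult_limit_group: "element u \<otimes>\<^bsub>G\<^esub> element v = element (u @ v)" for u v :: "'a list"
  by (simp add: G_def limit_group_def element_eq_iff limit_congruence_append[OF element_word element_word])

lemma element_relator: "element (word_power (relator_exponent w) w) = element ([] :: 'a list)"
  for w :: "'a list"
  by (simp add: element_eq_iff limit_congruence_relator)

lemma group_limit_group: "group G"
proof (rule groupI)
  fix x assume "x \<in> carrier G"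
  then obtain u :: "'a list" where u: "x = element u" by (auto simp: carrier_limit_group)
  obtain n where n: "relator_exponent u = Suc n"
    using relator_exponent_pos gr0_implies_Suc by blast
  have "element (word_power n u) \<otimes>\<^bsub>G\<^esub> x = element (word_power n u @ u)"
    unfolding u by (rule mult_limit_group)
  also have "word_power n u @ u = word_power (relator_exponent u) u"
    by (simp add: n word_power_commute)
  finally have "element (word_power n u) \<otimes>\<^bsub>G\<^esub> x = \<one>\<^bsub>G\<^esub>"
    by (simp add: element_relator one_limit_group)
  then show "\<exists>y\<in>carrier G. y \<otimes>\<^bsub>G\<^esub> x = \<one>\<^bsub>G\<^esub>"
    by (auto simp: carrier_limit_group)
qed (auto simp: carrier_limit_group one_limit_group mult_limit_group)

lemma power_limit_group: "element u [^]\<^bsub>G\<^esub> n = element (word_power n u)" for u :: "'a list" and n :: nat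
proof -
  interpret group G by (rule group_limit_group)
  show ?thesis
    by (induction n) (simp_all add: one_limit_group mult_limit_group word_power_commute)
qed

lemma torsion_limit_group: "torsion_group G"
  unfolding torsion_group_def
proof (intro conjI ballI)
  fix x assume "x \<in> carrier G"
  then obtain u :: "'a list" where u: "x = element u" by (auto simp: carrier_limit_group)
  show "\<exists>n::nat. n > 0 \<and> x [^]\<^bsub>G\<^esub> n = \<one>\<^bsub>G\<^esub>"
    by (intro exI[of _ "relator_exponent u"])
      (simp add: u relator_exponent_pos power_limit_group element_relator one_limit_group)
qed (rule group_limit_group)

text \<open>
  The identity belongs to \<open>S\<close> because the expansion of \<open>F\<close> was measured on \<open>F \<union> X F\<close>.
\<close>

lemma not_amenable_limit_group:
  assumes "3 \<le> card (UNIV :: 'a set)"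
  shows "\<not> amenable_group G"
proof -
  interpret group G by (rule group_limit_group)
  define S where "S = insert \<one>\<^bsub>G\<^esub> (range (\<lambda>x :: 'a. element [x]))"
  show ?thesis
  proof (rule doubling_not_amenable)
    show "finite S" by (simp add: S_def)
    show "S \<subseteq> carrier G" by (auto simp: S_def carrier_limit_group one_limit_group)
    fix F assume F: "finite F" "F \<subseteq> carrier G"
    define W where "W = (from_nat :: nat \<Rightarrow> 'a list) ` F"
    have word: "element (from_nat g :: 'a list) = g" if "g \<in> F" for g
    proof -
      obtain u :: "'a list" where "g = element u" using F \<open>g \<in> F\<close> by (auto simp: carrier_limit_group)
      then show ?thesis by (simp add: element_eq_iff element_word)
    qed
    have elements: "element ` W = F" using word by (force simp: W_def image_image)
    have "card W \<le> card F" using F card_image_le by (simp add: W_def)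
    moreover have "card F \<le> card W" using elements F card_image_le[of W element] by (simp add: W_def)
    ultimately have card_W: "card W = card F" by simp
    then have "inj_on element W" using elements F by (intro eq_card_imp_inj_on) (auto simp: W_def)
    then have inj: "inj_on limit_congruence W"
      by (simp add: inj_on_def element_eq_iff limit_class_eq_iff)
    have "2 * card F \<le> (card (UNIV :: 'a set) - 1) * card W"
      unfolding card_W using assms by (intro mult_le_mono1) linarith
    also have "\<dots> \<le> card (element ` (W \<union> (\<lambda>(x, f). x # f) ` (UNIV \<times> W)))"
      unfolding card_elements using expansion[OF _ inj] F by (simp add: W_def)
    also have "element ` (W \<union> (\<lambda>(x, f). x # f) ` (UNIV \<times> W)) = S <#>\<^bsub>G\<^esub> F"
    proof -
      have "S <#>\<^bsub>G\<^esub> F = (\<lambda>g. \<one>\<^bsub>G\<^esub> \<otimes>\<^bsub>G\<^esub> g) ` F \<union> (\<lambda>(x :: 'a, g). element [x] \<otimes>\<^bsub>G\<^esub> g) ` (UNIV \<times> F)"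
        by (auto simp: set_mult_def S_def)
      also have "(\<lambda>g. \<one>\<^bsub>G\<^esub> \<otimes>\<^bsub>G\<^esub> g) ` F = element ` W"
        unfolding elements[symmetric] by (simp add: image_image one_limit_group mult_limit_group)
      also have "(\<lambda>(x :: 'a, g). element [x] \<otimes>\<^bsub>G\<^esub> g) ` (UNIV \<times> F)
          = element ` (\<lambda>(x, f). x # f) ` (UNIV \<times> W)"
        unfolding elements[symmetric]
        by (force simp: image_iff mult_limit_group)
      finally show ?thesis by (simp add: image_Un)
    qed
    finally show "2 * card F \<le> card (S <#>\<^bsub>G\<^esub> F)" .
  qed
qed

end

theorem corollary1:
  "\<exists>G :: nat monoid.
     group G \<and> infinite (carrier G) \<and> torsion_group G \<and> \<not> amenable_group G"
proof (intro exI conjI)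
  let ?G = "limit_group TYPE(bool option)"
  show group: "group ?G" by (rule group_limit_group)
  show "torsion_group ?G" by (rule torsion_limit_group)
  show not_amenable: "\<not> amenable_group ?G"
    by (rule not_amenable_limit_group) (simp add: UNIV_option_conv card_image)
  show "infinite (carrier ?G)"
    using group.finite_amenable[OF group] not_amenable by blast
qed

end
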